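(* Let $X$ be a compact $T_1$ space and let $B$ be a countable basis of $X$. Then there is a subset $\mathbb{P}\subseteq B$ that is an $\omega$-band-basis of $X$.
   Context: Let $(\mathbb{P},\leq)$ be a poset. A band of $\mathbb{P}$ is a finite subset $F\subseteq\mathbb{P}$ such that every $p\in\mathbb{P}$ is comparable to some $f\in F$ (i.e. $p\leq f$ or $f\leq p$). $\mathbb{P}$ is an $\omega$-poset if every principal filter $p^\leq=\{q\in\mathbb{P}:p\leq q\}$ is finite and, for each $n\in\omega$, the number of principal filters of size $n$ is finite. A basis $\mathbb{P}$ of a topological space $X$, ordered by inclusion, is a band-basis if, for all finite $F\subseteq\mathbb{P}$, $F$ is a band of $\mathbb{P}$ if and only if $X=\bigcup F$. It is an $\omega$-band-basis if it is a band-basis and also an $\omega$-poset with respect to inclusion. *)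

theory Defs
  imports "HOL-Analysis.Analysis"
begin

text \<open>A poset is given as a set \<open>P\<close> of elements of an ordered type, with the induced order.
  On a type of sets this order is inclusion, so a family of sets is a poset ordered by inclusion.\<close>

definition band :: "'a::order set \<Rightarrow> 'a set \<Rightarrow> bool" where
  "band P F \<longleftrightarrow> finite F \<and> F \<subseteq> P \<and> (\<forall>p\<in>P. \<exists>f\<in>F. p \<le> f \<or> f \<le> p)"

definition principal_filter :: "'a::order set \<Rightarrow> 'a \<Rightarrow> 'a set" where
  "principal_filter P p = {q \<in> P. p \<le> q}"

definition omega_poset :: "'a::order set \<Rightarrow> bool" where
  "omega_poset P \<longleftrightarrow>
     (\<forall>p\<in>P. finite (principal_filter P p)) \<and>
     (\<forall>n. finite {S \<in> principal_filter P ` P. card S = n})"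

definition basis_of :: "'a topology \<Rightarrow> 'a set set \<Rightarrow> bool" where
  "basis_of X B \<longleftrightarrow>
     (\<forall>V\<in>B. openin X V) \<and>
     (\<forall>U x. openin X U \<and> x \<in> U \<longrightarrow> (\<exists>V\<in>B. x \<in> V \<and> V \<subseteq> U))"

lemma basis_of_iff_union_of: "basis_of X B \<longleftrightarrow> openin X = arbitrary union_of (\<lambda>V. V \<in> B)"
  unfolding basis_of_def openin_topology_base_unique by blast

definition band_basis :: "'a topology \<Rightarrow> 'a set set \<Rightarrow> bool" where
  "band_basis X P \<longleftrightarrow>
     basis_of X P \<and> (\<forall>F. finite F \<and> F \<subseteq> P \<longrightarrow> (band P F \<longleftrightarrow> topspace X = \<Union>F))"

definition omega_band_basis :: "'a topology \<Rightarrow> 'a set set \<Rightarrow> bool" where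
  "omega_band_basis X P \<longleftrightarrow> band_basis X P \<and> omega_poset P"

end

theory Submission
  imports Defs
begin

text \<open>
  The required family is \<open>P = (\<Union>n. C n)\<close> for a sequence of finite covers \<open>C n \<subseteq> B\<close> in which every
  \<open>p \<in> C n\<close> owns an \<^emph>\<open>anchor\<close>: a point of \<open>p\<close> that lies in no other member of \<open>C n\<close>, and such that
  every set of the earlier covers, and every one of the first \<open>n\<close> sets of \<open>B\<close>, that contains the
  anchor already contains all of \<open>p\<close>.

  Anchors decide comparability. If a finite \<open>F \<subseteq> P\<close> covers the space and \<open>p \<in> C n\<close>, then the
  anchor of \<open>p\<close> lies in some \<open>f \<in> F\<close>, say \<open>f \<in> C k\<close>. If \<open>k < n\<close> then \<open>p \<subseteq> f\<close> by the choice of the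
  anchor. If \<open>n \<le> k\<close> then \<open>f\<close> lies inside a member of \<open>C n\<close>, because later covers refine earlier ones,
  and this member contains the anchor of \<open>p\<close>, so it is \<open>p\<close>. Hence covers are bands. Conversely,
  if \<open>F\<close> misses a point \<open>x\<close>, a neighbourhood of \<open>x\<close> in \<open>P\<close> that omits one point of each \<open>f \<in> F\<close> is
  incomparable to all of \<open>F\<close>, so \<open>F\<close> is not a band; this is where the \<open>T\<^sub>1\<close> axiom enters.

  By compactness the covers \<open>C n\<close> eventually refine any given open cover. Applied to the covers
  by \<open>U\<close> and the complement of a point, this makes \<open>P\<close> a basis; applied to the complements of two
  points, it shows that only singletons can belong to infinitely many \<open>C n\<close>, which bounds the number
  of elements of \<open>P\<close> with a small principal filter.

  Anchored covers exist by a stratification of the space (lemma \<open>anchored_cover_exists\<close>): points are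
  covered in the order of the number of prescribed sets that contain them.
\<close>

section \<open>Covers with anchors\<close>

lemma irredundant_subcover:
  assumes "finite F" "R \<subseteq> \<Union>F"
  shows "\<exists>G\<subseteq>F. R \<subseteq> \<Union>G \<and> (\<forall>p\<in>G. \<exists>x\<in>R. x \<in> p \<and> (\<forall>q\<in>G. x \<in> q \<longrightarrow> q = p))"
  using assms
proof (induction F rule: finite_psubset_induct)
  case (psubset F)
  show ?case
  proof (cases "\<exists>p\<in>F. R \<subseteq> \<Union>(F - {p})")
    case True
    then obtain p where p: "p \<in> F" "R \<subseteq> \<Union>(F - {p})" by blast
    then have "F - {p} \<subset> F" by blast
    from psubset.IH[OF this p(2)] show ?thesis by (meson Diff_subset subset_trans)
  next
    case False
    have "\<exists>x\<in>R. x \<in> p \<and> (\<forall>q\<in>F. x \<in> q \<longrightarrow> q = p)" if "p \<in> F" for p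
    proof -
      from False that obtain x where "x \<in> R" "x \<notin> \<Union>(F - {p})" by blast
      with psubset.prems show ?thesis by blast
    qed
    with psubset.prems show ?thesis by blast
  qed
qed

lemma openin_common_neighbourhood:
  assumes "finite E" "\<forall>f\<in>E. openin X f"
  shows "openin X (topspace X \<inter> \<Inter>{f \<in> E. x \<in> f})"
proof -
  have "openin X (\<Inter>(insert (topspace X) {f \<in> E. x \<in> f}))"
    using assms by (intro openin_Inter) auto
  then show ?thesis by simp
qed

lemma closedin_few_memberships:
  assumes "finite E" "\<forall>f\<in>E. openin X f"
  shows "closedin X {x \<in> topspace X. card {f \<in> E. x \<in> f} < m}"
proof -
  let ?S = "{x \<in> topspace X. m \<le> card {f \<in> E. x \<in> f}}"
  have "\<exists>T. openin X T \<and> x \<in> T \<and> T \<subseteq> ?S" if "x \<in> ?S" for x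
  proof (intro exI conjI)
    let ?T = "topspace X \<inter> \<Inter>{f \<in> E. x \<in> f}"
    show "openin X ?T" by (rule openin_common_neighbourhood[OF assms])
    show "x \<in> ?T" using that by auto
    show "?T \<subseteq> ?S"
    proof
      fix y assume y: "y \<in> ?T"
      have "card {f \<in> E. x \<in> f} \<le> card {f \<in> E. y \<in> f}"
        using assms(1) y by (intro card_mono) auto
      with y that show "y \<in> ?S" by auto
    qed
  qed
  then have "openin X ?S" by (subst openin_subopen) blast
  moreover have "topspace X - {x \<in> topspace X. card {f \<in> E. x \<in> f} < m} = ?S" by auto
  ultimately show ?thesis by (simp add: closedin_def)
qed

text \<open>
  An arbitrary irredundant refinement does not suffice: each \<open>p\<close> is chosen around some point \<open>y\<close>
  so as to respect the sets of \<open>E\<close> containing \<open>y\<close>, but the point that only \<open>p\<close> covers may lie in more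
  sets of \<open>E\<close> than \<open>y\<close> does. Covering the points in the order of the number of sets of \<open>E\<close> containing
  them removes the discrepancy. The points to be covered at stage \<open>k\<close> lie in exactly \<open>k\<close> of the sets,
  and they form a compact set, by \<open>closedin_few_memberships\<close>. A set chosen around such a \<open>y\<close> lies in all the
  \<open>k\<close> sets containing \<open>y\<close>, so it misses all anchors from earlier stages, and any point left to cover
  that it contains lies in exactly the same sets of \<open>E\<close> as \<open>y\<close>.
\<close>

lemma partial_anchored_cover_exists:
  assumes X: "compact_space X" and B: "basis_of X B"
    and E: "finite E" "\<forall>f\<in>E. openin X f"
  shows "\<exists>C. finite C \<and> C \<subseteq> B \<and> {x \<in> topspace X. card {f \<in> E. x \<in> f} < k} \<subseteq> \<Union>C \<and>
           (\<forall>p\<in>C. \<exists>x\<in>p. card {f \<in> E. x \<in> f} < k \<and> (\<forall>q\<in>C. x \<in> q \<longrightarrow> q = p)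
                         \<and> (\<forall>f\<in>E. x \<in> f \<longrightarrow> p \<subseteq> f))"
proof (induction k)
  case 0
  show ?case by (intro exI[of _ "{}"]) auto
next
  case (Suc k)
  let ?t = "\<lambda>x. {f \<in> E. x \<in> f}"
  have fin: "finite (?t x)" for x using E(1) by simp
  from Suc obtain C where C: "finite C" "C \<subseteq> B" "{x \<in> topspace X. card (?t x) < k} \<subseteq> \<Union>C"
    and anchor: "\<forall>p\<in>C. \<exists>x\<in>p. card (?t x) < k \<and> (\<forall>q\<in>C. x \<in> q \<longrightarrow> q = p)
                         \<and> (\<forall>f\<in>E. x \<in> f \<longrightarrow> p \<subseteq> f)"
    by (elim exE conjE)
  define R where "R = {x \<in> topspace X. card (?t x) < Suc k} - \<Union>C"
  have openC: "openin X (\<Union>C)" using B C(2) by (auto simp: basis_of_def)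
  have "closedin X R"
    unfolding R_def using closedin_few_memberships[OF E] openC by (rule closedin_diff)
  then have "compactin X R" using X by (rule closedin_compact_space[rotated])
  have cardR: "card (?t x) = k" "x \<in> topspace X" if "x \<in> R" for x
    using that C(3) unfolding R_def by (auto simp: less_Suc_eq)
  have "\<exists>V. V \<in> B \<and> y \<in> V \<and> V \<subseteq> topspace X \<inter> \<Inter>(?t y)" if "y \<in> R" for y
  proof -
    have "y \<in> topspace X \<inter> \<Inter>(?t y)" using cardR(2)[OF that] by simp
    with B openin_common_neighbourhood[OF E] show ?thesis unfolding basis_of_def by meson
  qed
  then obtain V where V: "\<And>y. y \<in> R \<Longrightarrow> V y \<in> B \<and> y \<in> V y \<and> V y \<subseteq> topspace X \<inter> \<Inter>(?t y)"
    by metis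
  have "\<And>W. W \<in> V ` R \<Longrightarrow> openin X W" using V B by (auto simp: basis_of_def)
  moreover have "R \<subseteq> \<Union>(V ` R)" using V by blast
  ultimately obtain F where "finite F" "F \<subseteq> V ` R" "R \<subseteq> \<Union>F"
    using \<open>compactin X R\<close> by (meson compactinD)
  from irredundant_subcover[OF this(1,3)] this obtain G where
    G: "finite G" "G \<subseteq> V ` R" "R \<subseteq> \<Union>G"
    and G_anchor: "\<And>p. p \<in> G \<Longrightarrow> \<exists>x\<in>R. x \<in> p \<and> (\<forall>q\<in>G. x \<in> q \<longrightarrow> q = p)"
    by (metis finite_subset subset_trans)
  have old: "\<exists>x\<in>p. card (?t x) < Suc k \<and> (\<forall>q\<in>C \<union> G. x \<in> q \<longrightarrow> q = p) \<and> (\<forall>f\<in>E. x \<in> f \<longrightarrow> p \<subseteq> f)"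
    if "p \<in> C" for p
  proof -
    from bspec[OF anchor that] obtain x where x: "x \<in> p" "card (?t x) < k" "\<forall>q\<in>C. x \<in> q \<longrightarrow> q = p"
      "\<forall>f\<in>E. x \<in> f \<longrightarrow> p \<subseteq> f" by blast
    have "x \<notin> q" if "q \<in> G" for q
    proof
      assume "x \<in> q"
      from G(2) that obtain y where y: "y \<in> R" "q = V y" by blast
      with \<open>x \<in> q\<close> V[of y] have "?t y \<subseteq> ?t x" by blast
      then have "card (?t y) \<le> card (?t x)" using fin by (intro card_mono)
      with x(2) cardR(1)[OF y(1)] show False by simp
    qed
    with x show ?thesis by (intro bexI[of _ x]) auto
  qed
  have new: "\<exists>x\<in>p. card (?t x) < Suc k \<and> (\<forall>q\<in>C \<union> G. x \<in> q \<longrightarrow> q = p) \<and> (\<forall>f\<in>E. x \<in> f \<longrightarrow> p \<subseteq> f)"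
    if "p \<in> G" for p
  proof -
    from G_anchor[OF that] obtain x where x: "x \<in> R" "x \<in> p" "\<forall>q\<in>G. x \<in> q \<longrightarrow> q = p" by blast
    from G(2) that obtain y where y: "y \<in> R" "p = V y" by blast
    with x(2) V[of y] have "?t y \<subseteq> ?t x" by blast
    then have "?t y = ?t x" using fin cardR(1)[OF x(1)] cardR(1)[OF y(1)] by (intro card_seteq) auto
    then have "\<forall>f\<in>E. x \<in> f \<longrightarrow> p \<subseteq> f" using V[OF y(1)] y(2) by blast
    moreover have "x \<notin> \<Union>C" using x(1) by (simp add: R_def)
    ultimately show ?thesis using x cardR(1)[OF x(1)] by (intro bexI[of _ x]) auto
  qed
  show ?case
  proof (intro exI[of _ "C \<union> G"] conjI)
    show "C \<union> G \<subseteq> B" using C(2) G(2) V by blast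
    show "{x \<in> topspace X. card (?t x) < Suc k} \<subseteq> \<Union>(C \<union> G)" using G(3) by (auto simp: R_def)
    show "\<forall>p\<in>C \<union> G. \<exists>x\<in>p. card (?t x) < Suc k \<and> (\<forall>q\<in>C \<union> G. x \<in> q \<longrightarrow> q = p)
            \<and> (\<forall>f\<in>E. x \<in> f \<longrightarrow> p \<subseteq> f)"
      using old new by blast
  qed (use C(1) G(1) in simp)
qed

lemma anchored_cover_exists:
  assumes X: "compact_space X" and B: "basis_of X B"
    and E: "finite E" "\<forall>f\<in>E. openin X f"
  shows "\<exists>C. finite C \<and> C \<subseteq> B \<and> \<Union>C = topspace X \<and>
           (\<forall>p\<in>C. \<exists>x\<in>p. (\<forall>q\<in>C. x \<in> q \<longrightarrow> q = p) \<and> (\<forall>f\<in>E. x \<in> f \<longrightarrow> p \<subseteq> f))"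
proof -
  have "card {f \<in> E. x \<in> f} < Suc (card E)" for x
    using E(1) by (simp add: card_mono less_Suc_eq_le)
  then have all: "{x \<in> topspace X. card {f \<in> E. x \<in> f} < Suc (card E)} = topspace X" by blast
  from partial_anchored_cover_exists[OF assms, of "Suc (card E)"] obtain C where
    C: "finite C" "C \<subseteq> B" "topspace X \<subseteq> \<Union>C"
    and anchor: "\<forall>p\<in>C. \<exists>x\<in>p. card {f \<in> E. x \<in> f} < Suc (card E)
      \<and> (\<forall>q\<in>C. x \<in> q \<longrightarrow> q = p) \<and> (\<forall>f\<in>E. x \<in> f \<longrightarrow> p \<subseteq> f)"
    unfolding all by (elim exE conjE)
  have "\<Union>C \<subseteq> topspace X"
    using B C(2) by (meson Sup_least basis_of_def openin_subset subsetD)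
  with C(3) have "\<Union>C = topspace X" by simp
  moreover have "\<forall>p\<in>C. \<exists>x\<in>p. (\<forall>q\<in>C. x \<in> q \<longrightarrow> q = p) \<and> (\<forall>f\<in>E. x \<in> f \<longrightarrow> p \<subseteq> f)"
  proof
    fix p assume "p \<in> C"
    from bspec[OF anchor this] obtain x where "x \<in> p" "\<forall>q\<in>C. x \<in> q \<longrightarrow> q = p"
      "\<forall>f\<in>E. x \<in> f \<longrightarrow> p \<subseteq> f" by (elim bexE conjE)
    then show "\<exists>x\<in>p. (\<forall>q\<in>C. x \<in> q \<longrightarrow> q = p) \<and> (\<forall>f\<in>E. x \<in> f \<longrightarrow> p \<subseteq> f)"
      by (intro bexI[of _ x] conjI)
  qed
  ultimately show ?thesis using C(1,2) by (intro exI[of _ C] conjI)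
qed

section \<open>Sequences of anchored covers\<close>

locale anchored_covers =
  fixes X :: "'a topology" and B :: "'a set set"
    and C :: "nat \<Rightarrow> 'a set set" and anchor :: "nat \<Rightarrow> 'a set \<Rightarrow> 'a"
  assumes compact: "compact_space X" and t1: "t1_space X" and basis: "basis_of X B"
    and finite_level: "finite (C n)"
    and level_subset: "C n \<subseteq> B"
    and level_cover: "\<Union>(C n) = topspace X"
    and anchor_mem: "p \<in> C n \<Longrightarrow> anchor n p \<in> p"
    and anchor_unique: "\<lbrakk>p \<in> C n; q \<in> C n; anchor n p \<in> q\<rbrakk> \<Longrightarrow> q = p"
    and anchor_below: "\<lbrakk>p \<in> C n; k < n; f \<in> C k; anchor n p \<in> f\<rbrakk> \<Longrightarrow> p \<subseteq> f"
    and anchor_basis: "b \<in> B \<Longrightarrow> \<exists>N. \<forall>n\<ge>N. \<forall>p\<in>C n. anchor n p \<in> b \<longrightarrow> p \<subseteq> b"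
begin

definition P :: "'a set set" where
  "P = (\<Union>n. C n)"

lemma openin_P: "p \<in> P \<Longrightarrow> openin X p"
  using level_subset basis by (auto simp: P_def basis_of_def)

lemma level_in_topspace: "p \<in> C n \<Longrightarrow> p \<subseteq> topspace X"
  using level_cover by blast

lemma openin_delete_point: "openin X (topspace X - {x})"
  using t1 openin_topspace by (rule t1_space_openin_delete_alt[THEN iffD1, rule_format])

lemma refines:
  assumes "k \<le> n" "p \<in> C n"
  shows "\<exists>c\<in>C k. p \<subseteq> c"
proof (cases "k = n")
  case True
  with assms show ?thesis by blast
next
  case False
  have "anchor n p \<in> \<Union>(C k)"
    using assms(2) anchor_mem level_in_topspace level_cover by blast
  with False assms anchor_below show ?thesis by (metis UnionE le_neq_implies_less)
qed

text \<open>
  Compactness replaces the cover by finitely many sets of \<open>B\<close>, all of which the anchors respect from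
  some level on. A later \<open>p\<close> lies in whichever of these sets contains its anchor.
\<close>

lemma eventually_refines_open_cover:
  assumes U: "\<And>u. u \<in> U \<Longrightarrow> openin X u" "topspace X \<subseteq> \<Union>U"
  shows "\<exists>N. \<forall>n\<ge>N. \<forall>p\<in>C n. \<exists>u\<in>U. p \<subseteq> u"
proof -
  let ?W = "{b \<in> B. \<exists>u\<in>U. b \<subseteq> u}"
  have "topspace X \<subseteq> \<Union>?W"
  proof
    fix x assume "x \<in> topspace X"
    with U obtain u where u: "u \<in> U" "x \<in> u" "openin X u" by blast
    with basis obtain b where "b \<in> B" "x \<in> b" "b \<subseteq> u" unfolding basis_of_def by blast
    with u show "x \<in> \<Union>?W" by blast
  qed
  moreover have "\<And>b. b \<in> ?W \<Longrightarrow> openin X b" using basis by (auto simp: basis_of_def)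
  ultimately obtain F where F: "finite F" "F \<subseteq> ?W" "topspace X \<subseteq> \<Union>F"
    using compact unfolding compact_space_def by (meson compactinD)
  have "\<forall>b\<in>F. \<exists>N. \<forall>n\<ge>N. \<forall>p\<in>C n. anchor n p \<in> b \<longrightarrow> p \<subseteq> b" using F(2) anchor_basis by blast
  then obtain N where N: "\<And>b n p. \<lbrakk>b \<in> F; N b \<le> n; p \<in> C n; anchor n p \<in> b\<rbrakk> \<Longrightarrow> p \<subseteq> b" by metis
  have "\<exists>u\<in>U. p \<subseteq> u" if n: "n \<ge> Max (insert 0 (N ` F))" and p: "p \<in> C n" for n p
  proof -
    have "anchor n p \<in> topspace X" using p anchor_mem level_in_topspace by blast
    with F(3) obtain b where b: "b \<in> F" "anchor n p \<in> b" by blast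
    have "N b \<le> n" using n b(1) F(1) by simp
    with b p N have "p \<subseteq> b" by blast
    moreover from F(2) b(1) obtain u where "u \<in> U" "b \<subseteq> u" by auto
    ultimately show ?thesis by (meson subset_trans)
  qed
  then show ?thesis by meson
qed

text \<open>
  If a level refines the cover by \<open>U\<close> and the complement of \<open>x\<close>, its members containing \<open>x\<close> have no
  choice but to lie inside \<open>U\<close>.
\<close>

lemma basis_of_P: "basis_of X P"
  unfolding basis_of_def
proof (intro conjI ballI allI impI)
  fix U x assume "openin X U \<and> x \<in> U"
  then have U: "openin X U" "x \<in> U" "x \<in> topspace X" using openin_subset by blast+
  have "\<exists>N. \<forall>n\<ge>N. \<forall>p\<in>C n. \<exists>u\<in>{U, topspace X - {x}}. p \<subseteq> u"
    using U openin_delete_point by (intro eventually_refines_open_cover) auto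
  then obtain N where N: "\<forall>p\<in>C N. \<exists>u\<in>{U, topspace X - {x}}. p \<subseteq> u" by blast
  from U(3) level_cover obtain p where "p \<in> C N" "x \<in> p" by blast
  with N show "\<exists>V\<in>P. x \<in> V \<and> V \<subseteq> U" unfolding P_def by blast
qed (rule openin_P)

lemma nonsingleton_eventually_gone:
  assumes "\<not> is_singleton g"
  shows "\<exists>N. \<forall>n\<ge>N. g \<notin> C n"
proof (cases "g \<in> P")
  case False
  then show ?thesis by (auto simp: P_def)
next
  case True
  then have "g \<noteq> {}" using anchor_mem by (auto simp: P_def)
  with assms obtain y z where yz: "y \<in> g" "z \<in> g" "y \<noteq> z" by (metis is_singletonI')
  have "\<exists>N. \<forall>n\<ge>N. \<forall>p\<in>C n. \<exists>u\<in>{topspace X - {y}, topspace X - {z}}. p \<subseteq> u"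
    using yz openin_delete_point by (intro eventually_refines_open_cover) auto
  with yz show ?thesis by blast
qed

text \<open>
  Refinement traps \<open>q\<close> between \<open>p\<close> and some \<open>c \<in> C n\<close>; as \<open>c\<close> contains the anchor of \<open>p\<close>, it is
  \<open>p\<close>. So the sets strictly above \<open>p\<close> occur only in levels before \<open>n\<close>.
\<close>

lemma above_is_earlier:
  assumes "p \<in> C n" "q \<in> C k" "p \<subseteq> q" "n \<le> k"
  shows "q = p"
proof -
  from refines[OF assms(4,2)] obtain c where "c \<in> C n" "q \<subseteq> c" by blast
  moreover from this assms(1,3) anchor_mem anchor_unique have "c = p" by blast
  ultimately show ?thesis using assms(3) by blast
qed

lemma finite_levels: "finite (\<Union>k\<le>n. C k)"
  using finite_level by blast

lemma finite_principal_filter: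
  assumes "p \<in> P"
  shows "finite (principal_filter P p)"
proof -
  from assms obtain n where n: "p \<in> C n" by (auto simp: P_def)
  have "principal_filter P p \<subseteq> (\<Union>k\<le>n. C k)"
  proof
    fix q assume "q \<in> principal_filter P p"
    then obtain k where q: "q \<in> C k" "p \<subseteq> q" by (auto simp: principal_filter_def P_def)
    show "q \<in> (\<Union>k\<le>n. C k)"
      using above_is_earlier[OF n q] n q(1) by (cases "n \<le> k") auto
  qed
  then show ?thesis using finite_levels by (rule finite_subset)
qed

text \<open>
  Induction on \<open>m\<close>: a set \<open>p\<close> appearing for the first time after level \<open>N\<close> lies strictly below
  some \<open>c \<in> C N\<close>, whose filter is therefore smaller. There are finitely many candidates for \<open>c\<close>, and
  if \<open>N\<close> is large only singletons among them are still in \<open>C N\<close>; but nothing lies strictly below a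
  singleton.
\<close>

lemma finite_small_filters: "finite {p \<in> P. card (principal_filter P p) \<le> m}"
proof (induction m)
  case 0
  have "card (principal_filter P p) \<noteq> 0" if "p \<in> P" for p
    using finite_principal_filter[OF that] that by (auto simp: principal_filter_def)
  then have "{p \<in> P. card (principal_filter P p) \<le> 0} = {}" by blast
  then show ?case by (simp only: finite.emptyI)
next
  case (Suc m)
  let ?G = "{p \<in> P. card (principal_filter P p) \<le> m}"
  have "\<forall>g. \<exists>N. \<not> is_singleton g \<longrightarrow> (\<forall>n\<ge>N. g \<notin> C n)"
    using nonsingleton_eventually_gone by blast
  then obtain N where N: "\<And>g n. \<lbrakk>\<not> is_singleton g; N g \<le> n\<rbrakk> \<Longrightarrow> g \<notin> C n" by metis
  define M where "M = Max (insert 0 (N ` ?G))"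
  have M: "is_singleton g" if "g \<in> ?G" "g \<in> C M" for g
  proof -
    have "N g \<le> M" unfolding M_def using Suc that(1) by (intro Max_ge) auto
    with N that(2) show ?thesis by blast
  qed
  have "{p \<in> P. card (principal_filter P p) \<le> Suc m} \<subseteq> (\<Union>k\<le>M. C k)"
  proof
    fix p assume "p \<in> {p \<in> P. card (principal_filter P p) \<le> Suc m}"
    then obtain n where p: "p \<in> P" "card (principal_filter P p) \<le> Suc m" "p \<in> C n"
      by (auto simp: P_def)
    show "p \<in> (\<Union>k\<le>M. C k)"
    proof (rule ccontr)
      assume late: "p \<notin> (\<Union>k\<le>M. C k)"
      with p(3) have "M \<le> n" by (cases "M \<le> n") auto
      from refines[OF this p(3)] obtain c where c: "c \<in> C M" "p \<subseteq> c" by blast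
      have "c \<noteq> p" using late c(1) by blast
      have "c \<in> P" using c(1) by (auto simp: P_def)
      have "principal_filter P c \<subset> principal_filter P p"
        using c(2) \<open>c \<noteq> p\<close> p(1) by (auto simp: principal_filter_def)
      then have "card (principal_filter P c) < card (principal_filter P p)"
        using finite_principal_filter[OF p(1)] by (intro psubset_card_mono)
      with p(2) \<open>c \<in> P\<close> c(1) M have "is_singleton c" by simp
      then obtain y where "c = {y}" by (auto simp: is_singleton_def)
      with c(2) \<open>c \<noteq> p\<close> anchor_mem[OF p(3)] show False by blast
    qed
  qed
  then show ?case using finite_levels by (rule finite_subset)
qed

lemma omega_poset_P: "omega_poset P"
  unfolding omega_poset_def
proof (intro conjI ballI allI)
  fix n
  have "{S \<in> principal_filter P ` P. card S = n}
      \<subseteq> principal_filter P ` {p \<in> P. card (principal_filter P p) \<le> n}" by blast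
  then show "finite {S \<in> principal_filter P ` P. card S = n}"
    by (rule finite_subset) (rule finite_imageI[OF finite_small_filters])
qed (rule finite_principal_filter)

lemma cover_imp_band:
  assumes F: "finite F" "F \<subseteq> P" "topspace X = \<Union>F"
  shows "band P F"
  unfolding band_def
proof (intro conjI ballI F)
  fix p assume "p \<in> P"
  then obtain n where p: "p \<in> C n" by (auto simp: P_def)
  then have "anchor n p \<in> \<Union>F" using anchor_mem level_in_topspace F(3) by blast
  then obtain f where f: "f \<in> F" "anchor n p \<in> f" by blast
  with F(2) obtain k where k: "f \<in> C k" by (auto simp: P_def)
  have "p \<subseteq> f \<or> f \<subseteq> p"
  proof (cases "k < n")
    case True
    with p k f(2) anchor_below show ?thesis by blast
  next
    case False
    with refines k obtain c where c: "c \<in> C n" "f \<subseteq> c" by (meson not_less)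
    with f(2) p anchor_unique have "c = p" by blast
    with c show ?thesis by blast
  qed
  with f(1) show "\<exists>f\<in>F. p \<subseteq> f \<or> f \<subseteq> p" by blast
qed

lemma band_imp_cover:
  assumes "band P F"
  shows "topspace X = \<Union>F"
proof
  from assms have F: "finite F" "F \<subseteq> P" by (auto simp: band_def)
  show "\<Union>F \<subseteq> topspace X" using F(2) openin_P openin_subset by blast
  show "topspace X \<subseteq> \<Union>F"
  proof
    fix x assume x: "x \<in> topspace X"
    show "x \<in> \<Union>F"
    proof (rule ccontr)
      assume out: "x \<notin> \<Union>F"
      have "\<forall>f\<in>F. \<exists>y. y \<in> f" using F(2) anchor_mem by (fastforce simp: P_def)
      then obtain y where y: "\<And>f. f \<in> F \<Longrightarrow> y f \<in> f" by metis
      let ?U = "topspace X - y ` F"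
      have "y ` F \<subseteq> topspace X" using y \<open>\<Union>F \<subseteq> topspace X\<close> by blast
      with F(1) t1 have "closedin X (y ` F)" by (simp add: t1_space_closedin_finite)
      then have "openin X ?U" by blast
      moreover have "x \<in> ?U" using x y out by auto
      ultimately obtain p where p: "p \<in> P" "x \<in> p" "p \<subseteq> ?U"
        using basis_of_P unfolding basis_of_def by blast
      then obtain f where "f \<in> F" "p \<subseteq> f \<or> f \<subseteq> p" using assms by (auto simp: band_def)
      with p y out show False by blast
    qed
  qed
qed

lemma omega_band_basis_P: "omega_band_basis X P"
  unfolding omega_band_basis_def band_basis_def
  by (metis basis_of_P cover_imp_band band_imp_cover omega_poset_P)

end

section \<open>Construction of the sequence\<close>

text \<open>
  \<open>E n\<close> collects the sets that the anchors of the \<open>n\<close>-th cover must respect. It absorbs each cover as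
  it is built, together with an initial segment of the enumeration of \<open>B\<close>.
\<close>

lemma anchored_covers_exist:
  assumes X: "compact_space X" "t1_space X" and "countable B" and B: "basis_of X B"
  shows "\<exists>C anchor. anchored_covers X B C anchor"
proof -
  define I where "I n = to_nat_on B -` {..<n} \<inter> B" for n :: nat
  have I: "finite (I n)" for n
    unfolding I_def using \<open>countable B\<close> by (intro finite_vimage_IntI) auto
  have "\<exists>C. finite C \<and> C \<subseteq> B \<and> \<Union>C = topspace X \<and>
           (\<forall>p\<in>C. \<exists>x\<in>p. (\<forall>q\<in>C. x \<in> q \<longrightarrow> q = p) \<and> (\<forall>f\<in>E. x \<in> f \<longrightarrow> p \<subseteq> f))"
    if "finite E" "E \<subseteq> B" for E
    using that B by (intro anchored_cover_exists[OF X(1) B]) (auto simp: basis_of_def)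
  then obtain R where R: "\<And>E. \<lbrakk>finite E; E \<subseteq> B\<rbrakk> \<Longrightarrow> finite (R E) \<and> R E \<subseteq> B \<and> \<Union>(R E) = topspace X \<and>
           (\<forall>p\<in>R E. \<exists>x\<in>p. (\<forall>q\<in>R E. x \<in> q \<longrightarrow> q = p) \<and> (\<forall>f\<in>E. x \<in> f \<longrightarrow> p \<subseteq> f))"
    by metis
  define E where "E = rec_nat {} (\<lambda>n D. D \<union> R D \<union> I (Suc n))"
  have E_Suc: "E (Suc n) = E n \<union> R (E n) \<union> I (Suc n)" and E_0: "E 0 = {}" for n
    by (simp_all add: E_def)
  have E: "finite (E n) \<and> E n \<subseteq> B" for n
  proof (induction n)
    case (Suc n)
    then show ?case using R[of "E n"] I[of "Suc n"] by (auto simp: E_Suc I_def)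
  qed (simp add: E_0)
  have "E k \<subseteq> E n" if "k \<le> n" for k n
    using that by (rule lift_Suc_mono_le[rotated]) (auto simp: E_Suc)
  then have earlier: "R (E k) \<subseteq> E n" if "k < n" for k n
    using E_Suc[of k] that by (metis Suc_leI le_sup_iff subset_trans sup_ge1)
  have enum: "b \<in> E n" if "b \<in> B" "to_nat_on B b < n" for b n
    using that by (cases n) (auto simp: E_Suc I_def)
  have level: "finite (R (E n))" "R (E n) \<subseteq> B" "\<Union>(R (E n)) = topspace X"
    and pinned: "\<forall>p\<in>R (E n). \<exists>x\<in>p. (\<forall>q\<in>R (E n). x \<in> q \<longrightarrow> q = p) \<and> (\<forall>f\<in>E n. x \<in> f \<longrightarrow> p \<subseteq> f)" for n
    using R[of "E n"] E[of n] by simp_all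
  define a where "a n p = (SOME x. x \<in> p \<and> (\<forall>q\<in>R (E n). x \<in> q \<longrightarrow> q = p)
      \<and> (\<forall>f\<in>E n. x \<in> f \<longrightarrow> p \<subseteq> f))" for n p
  have a: "a n p \<in> p \<and> (\<forall>q\<in>R (E n). a n p \<in> q \<longrightarrow> q = p) \<and> (\<forall>f\<in>E n. a n p \<in> f \<longrightarrow> p \<subseteq> f)"
    if "p \<in> R (E n)" for n p
    unfolding a_def using bspec[OF pinned that] unfolding Bex_def by (rule someI_ex)
  have "anchored_covers X B (\<lambda>n. R (E n)) a"
  proof
    fix b assume b: "b \<in> B"
    have "p \<subseteq> b" if "Suc (to_nat_on B b) \<le> n" "p \<in> R (E n)" "a n p \<in> b" for n p
      using a[OF that(2)] enum[OF b] that by auto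
    then show "\<exists>N. \<forall>n\<ge>N. \<forall>p\<in>R (E n). a n p \<in> b \<longrightarrow> p \<subseteq> b" by meson
  next
    fix p n k f assume p: "p \<in> R (E n)" and "k < n" "f \<in> R (E k)" "a n p \<in> f"
    with earlier[of k n] a[OF p] show "p \<subseteq> f" by (meson subsetD)
  next
    fix p n assume "p \<in> R (E n)"
    from a[OF this] show "a n p \<in> p" ..
  next
    fix p q n assume "p \<in> R (E n)" "q \<in> R (E n)" "a n p \<in> q"
    with a[OF this(1)] show "q = p" by simp
  qed (fact X B level)+
  then show ?thesis by blast
qed

theorem theorem1p29:
  fixes X :: "'a topology" and B :: "'a set set"
  assumes "compact_space X"
    and "t1_space X"
    and "countable B"
    and "basis_of X B"
  shows "\<exists>P\<subseteq>B. omega_band_basis X P"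
proof -
  from anchored_covers_exist[OF assms] obtain C a where "anchored_covers X B C a" by blast
  then interpret anchored_covers X B C a .
  have "P \<subseteq> B" using level_subset by (auto simp: P_def)
  with omega_band_basis_P show ?thesis by blast
qed

end
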